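(* Let $k\geq 1$ be an integer and let $G$ be a finite (not necessarily simple) graph with $e(G)>k\,(v(G)-1)$. Then $G$ contains a subgraph $G'$ such that: (i) $e(G')>k\,(v(G')-1)$; (ii) $G'$ is $(k+1)$-edge-connected; (iii) $G'$ contains $k$ pairwise edge-disjoint spanning trees; (iv) if $G$ is simple, then $v(G')>2k$.
   Context: Graphs may have parallel edges (loops are not considered). $v(G)$ and $e(G)$ denote the numbers of vertices and edges (counted with multiplicity). A graph $H$ is $(k+1)$-edge-connected if for every partition of $V(H)$ into two nonempty sets, at least $k+1$ edges join the two sets. *)

theory Defs
  imports "HOL-Library.Disjoint_Sets"
begin

record ('v, 'e) multigraph =
  verts :: "'v set"
  edges :: "'e set"
  ends :: "'e \<Rightarrow> 'v set"

text \<open>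
  Edges are objects of their own, so that parallel edges are distinct edges with the same
  end set; an end set with exactly two elements excludes loops. Graphs are nonempty, as usual:
  the null graph would satisfy \<open>0 > k (0 - 1)\<close> and contains no nontrivial subgraph.
\<close>

locale fin_multigraph =
  fixes G :: "('v, 'e) multigraph"
  assumes finite_verts: "finite (verts G)"
    and finite_edges: "finite (edges G)"
    and verts_nonempty: "verts G \<noteq> {}"
    and ends_subset: "e \<in> edges G \<Longrightarrow> ends G e \<subseteq> verts G"
    and card_ends: "e \<in> edges G \<Longrightarrow> card (ends G e) = 2"

definition num_verts :: "('v, 'e) multigraph \<Rightarrow> nat" where
  "num_verts G = card (verts G)"

definition num_edges :: "('v, 'e) multigraph \<Rightarrow> nat" where
  "num_edges G = card (edges G)"

definition simple_graph :: "('v, 'e) multigraph \<Rightarrow> bool" where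
  "simple_graph G \<longleftrightarrow> fin_multigraph G \<and> inj_on (ends G) (edges G)"

definition subgraph :: "('v, 'e) multigraph \<Rightarrow> ('v, 'e) multigraph \<Rightarrow> bool" where
  "subgraph H G \<longleftrightarrow> fin_multigraph H \<and> verts H \<subseteq> verts G \<and> edges H \<subseteq> edges G \<and>
     (\<forall>e\<in>edges H. ends H e = ends G e)"

definition edges_between :: "('v, 'e) multigraph \<Rightarrow> 'v set \<Rightarrow> 'v set \<Rightarrow> 'e set" where
  "edges_between G A B = {e \<in> edges G. \<exists>a\<in>A. \<exists>b\<in>B. ends G e = {a, b}}"

definition edge_connected :: "nat \<Rightarrow> ('v, 'e) multigraph \<Rightarrow> bool" where
  "edge_connected n G \<longleftrightarrow>
     (\<forall>A B. A \<noteq> {} \<and> B \<noteq> {} \<and> A \<inter> B = {} \<and> A \<union> B = verts G \<longrightarrow>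
        n \<le> card (edges_between G A B))"

fun walk :: "('v, 'e) multigraph \<Rightarrow> 'v \<Rightarrow> 'e list \<Rightarrow> 'v \<Rightarrow> bool" where
  "walk G u [] v \<longleftrightarrow> u = v \<and> u \<in> verts G"
| "walk G u (e # es) v \<longleftrightarrow> e \<in> edges G \<and> (\<exists>w. ends G e = {u, w} \<and> walk G w es v)"

definition connected_graph :: "('v, 'e) multigraph \<Rightarrow> bool" where
  "connected_graph G \<longleftrightarrow> (\<forall>u\<in>verts G. \<forall>v\<in>verts G. \<exists>es. walk G u es v)"

text \<open>
  The edge \<open>es ! i\<close> joins \<open>vs ! i\<close> to its cyclic successor. Two parallel edges form a cycle
  of length 2.
\<close>

definition is_cycle :: "('v, 'e) multigraph \<Rightarrow> 'v list \<Rightarrow> 'e list \<Rightarrow> bool" where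
  "is_cycle G vs es \<longleftrightarrow> length vs = length es \<and> 2 \<le> length es \<and> distinct vs \<and> distinct es \<and>
     (\<forall>i<length es. es ! i \<in> edges G \<and> ends G (es ! i) = {vs ! i, vs ! (Suc i mod length vs)})"

definition tree :: "('v, 'e) multigraph \<Rightarrow> bool" where
  "tree T \<longleftrightarrow> fin_multigraph T \<and> connected_graph T \<and> (\<nexists>vs es. is_cycle T vs es)"

definition spanning_tree :: "('v, 'e) multigraph \<Rightarrow> ('v, 'e) multigraph \<Rightarrow> bool" where
  "spanning_tree T G \<longleftrightarrow> subgraph T G \<and> verts T = verts G \<and> tree T"

definition has_edge_disjoint_spanning_trees :: "nat \<Rightarrow> ('v, 'e) multigraph \<Rightarrow> bool" where
  "has_edge_disjoint_spanning_trees k G \<longleftrightarrow>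
     (\<exists>T. (\<forall>i<k. spanning_tree (T i) G) \<and> disjoint_family_on (\<lambda>i. edges (T i)) {..<k})"

end

theory Submission
  imports Defs
begin

text \<open>
  Choose a subgraph with more than \<open>k (v - 1)\<close> edges and as few vertices as possible; connectivity
  and the bound on the order in the simple case follow by counting edges. For the trees, take
  \<open>k\<close> disjoint forests \<open>I\<^sub>1, \<dots>, I\<^sub>k\<close> covering as many edges as possible; some edge
  \<open>e\<^sub>0\<close> is left over. Let \<open>A\<close> be the set of edges left over by some family
  that arises from the \<open>I\<^sub>i\<close> by exchanging edges one at a time. Then each \<open>I\<^sub>i \<inter> A\<close>
  spans \<open>A\<close>, so the component \<open>U\<close> of \<open>e\<^sub>0\<close> in \<open>A\<close> carries at least \<open>k (|U| - 1) + 1\<close> edges. By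
  minimality \<open>U\<close> contains all vertices, and every \<open>I\<^sub>i\<close> is a spanning tree.
\<close>

section \<open>Packing independent sets\<close>

text \<open>A finite matroid presented by its closure operator; for graphs these axioms follow
  directly from reachability.\<close>

locale pregeometry =
  fixes E :: "'e set" and cl :: "'e set \<Rightarrow> 'e set"
  assumes finite_ground: "finite E"
    and cl_subset: "cl A \<subseteq> E"
    and cl_extensive: "A \<subseteq> E \<Longrightarrow> A \<subseteq> cl A"
    and cl_mono: "A \<subseteq> B \<Longrightarrow> cl A \<subseteq> cl B"
    and cl_idem: "cl (cl A) \<subseteq> cl A"
    and cl_exchange: "\<lbrakk>y \<in> E; x \<in> cl (insert y A); x \<notin> cl A\<rbrakk> \<Longrightarrow> y \<in> cl (insert x A)"
begin

definition indep :: "'e set \<Rightarrow> bool" where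
  "indep I \<longleftrightarrow> I \<subseteq> E \<and> (\<forall>e\<in>I. e \<notin> cl (I - {e}))"

lemma indep_empty: "indep {}"
  by (simp add: indep_def)

lemma indep_subset: "\<lbrakk>indep I; J \<subseteq> I\<rbrakk> \<Longrightarrow> indep J"
  unfolding indep_def using cl_mono by (meson Diff_mono subset_iff subset_refl subset_trans)

lemma cl_least: "A \<subseteq> cl B \<Longrightarrow> cl A \<subseteq> cl B"
  using cl_mono cl_idem by blast

text \<open>For \<open>x\<close> in \<open>I\<close>, if \<open>x\<close> fell into the closure of
  the other elements of \<open>insert e I\<close>, the exchange axiom would put \<open>e\<close>
  into \<open>cl I\<close>.\<close>

lemma indep_insert:
  assumes "indep I" "e \<in> E" "e \<notin> cl I"
  shows "indep (insert e I)"
  unfolding indep_def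
proof (intro conjI ballI)
  show "insert e I \<subseteq> E"
    using assms by (auto simp: indep_def)
  have "e \<notin> I"
    using assms cl_extensive by (auto simp: indep_def)
  fix x assume x: "x \<in> insert e I"
  show "x \<notin> cl (insert e I - {x})"
  proof (cases "x = e")
    case True
    then show ?thesis using \<open>e \<notin> I\<close> assms(3) by simp
  next
    case False
    then have "x \<in> I" using x by simp
    then have "x \<notin> cl (I - {x})" "insert x (I - {x}) = I"
      "insert e I - {x} = insert e (I - {x})"
      using assms(1) False by (auto simp: indep_def)
    then show ?thesis
      using cl_exchange[OF assms(2), of x "I - {x}"] assms(3) by auto
  qed
qed

section \<open>Packings and single exchanges\<close>

definition packing :: "nat \<Rightarrow> (nat \<Rightarrow> 'e set) \<Rightarrow> bool" where
  "packing k I \<longleftrightarrow> (\<forall>i<k. indep (I i)) \<and> disjoint_family_on I {..<k}"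

definition covered :: "nat \<Rightarrow> (nat \<Rightarrow> 'e set) \<Rightarrow> 'e set" where
  "covered k I = (\<Union>i<k. I i)"

definition max_packing :: "nat \<Rightarrow> (nat \<Rightarrow> 'e set) \<Rightarrow> bool" where
  "max_packing k I \<longleftrightarrow>
     packing k I \<and> (\<forall>J. packing k J \<longrightarrow> card (covered k J) \<le> card (covered k I))"

text \<open>The closure condition keeps the new member independent. When \<open>e\<close> lies in
  \<open>cl (I i)\<close>, it says that \<open>f\<close> belongs to the fundamental circuit of
  \<open>e\<close>.\<close>

definition exchange :: "nat \<Rightarrow> (nat \<Rightarrow> 'e set) \<Rightarrow> (nat \<Rightarrow> 'e set) \<Rightarrow> bool" where
  "exchange k I J \<longleftrightarrow>
     (\<exists>i<k. \<exists>e\<in>E - covered k I. \<exists>f\<in>I i. e \<notin> cl (I i - {f}) \<and>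
        J = I(i := insert e (I i - {f})))"

lemma covered_subset: "packing k I \<Longrightarrow> covered k I \<subseteq> E"
  by (auto simp: packing_def covered_def indep_def)

lemma finite_covered: "packing k I \<Longrightarrow> finite (covered k I)"
  using covered_subset finite_ground finite_subset by blast

lemma max_packing_exists: "\<exists>I. max_packing k I"
proof -
  have "packing k (\<lambda>_. {})"
    by (simp add: packing_def indep_empty disjoint_family_on_def)
  moreover have "\<forall>I. packing k I \<longrightarrow> card (covered k I) < Suc (card E)"
    by (simp add: card_mono covered_subset finite_ground less_Suc_eq_le)
  ultimately obtain I where "packing k I"
    "\<forall>J. packing k J \<longrightarrow> card (covered k J) \<le> card (covered k I)"
    using ex_has_greatest_nat[of "packing k" _ "\<lambda>I. card (covered k I)"] by blast
  then show ?thesis by (auto simp: max_packing_def)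
qed

lemma packing_disjoint:
  assumes "packing k I" "i < k"
  shows "I i \<inter> (\<Union>j\<in>{..<k} - {i}. I j) = {}"
  using assms unfolding packing_def disjoint_family_on_def by blast

lemma packing_update:
  assumes "packing k I" "i < k" "indep X" "X \<inter> (\<Union>j\<in>{..<k} - {i}. I j) = {}"
  shows "packing k (I(i := X))"
  using assms by (fastforce simp: packing_def disjoint_family_on_def)

text \<open>Otherwise \<open>e\<close> could join \<open>I i\<close>, and the packing would cover
  one more element.\<close>

lemma uncovered_in_cl:
  assumes I: "max_packing k I" and i: "i < k" and e: "e \<in> E - covered k I"
  shows "e \<in> cl (I i)"
proof (rule ccontr)
  assume "e \<notin> cl (I i)"
  have pack: "packing k I"
    using I by (simp add: max_packing_def)
  let ?J = "I(i := insert e (I i))"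
  have "indep (insert e (I i))"
    using indep_insert \<open>e \<notin> cl (I i)\<close> e pack i by (auto simp: packing_def)
  moreover have "insert e (I i) \<inter> (\<Union>j\<in>{..<k} - {i}. I j) = {}"
    using e packing_disjoint[OF pack i] by (auto simp: covered_def)
  ultimately have "packing k ?J"
    using packing_update pack i by blast
  moreover have "covered k ?J = insert e (covered k I)"
    using i by (auto simp: covered_def split: if_splits)
  moreover have "card (insert e (covered k I)) = Suc (card (covered k I))"
    using e finite_covered[OF pack] by simp
  ultimately show False
    using I by (metis max_packing_def not_less_eq_eq order_refl)
qed

text \<open>The element \<open>e\<close> enters the covered set as \<open>f\<close> leaves it, so
  the number of covered elements does not change.\<close>

lemma exchange_max_packing:
  assumes I: "max_packing k I" and "exchange k I J"
  shows "max_packing k J"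
proof -
  obtain i e f where i: "i < k" and e: "e \<in> E" "e \<notin> covered k I" and f: "f \<in> I i"
    and ef: "e \<notin> cl (I i - {f})" and J: "J = I(i := insert e (I i - {f}))"
    using assms(2) by (auto simp: exchange_def)
  have pack: "packing k I"
    using I by (simp add: max_packing_def)
  have disj: "I i \<inter> (\<Union>j\<in>{..<k} - {i}. I j) = {}"
    using packing_disjoint pack i .
  have "indep (insert e (I i - {f}))"
    using indep_insert[OF _ e(1) ef] indep_subset pack i by (auto simp: packing_def)
  moreover have "insert e (I i - {f}) \<inter> (\<Union>j\<in>{..<k} - {i}. I j) = {}"
    using disj e by (auto simp: covered_def)
  ultimately have "packing k J"
    unfolding J using packing_update pack i by blast
  have "covered k J = insert e (covered k I - {f})"
  proof
    show "covered k J \<subseteq> insert e (covered k I - {f})"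
      using i f disj unfolding J covered_def by (fastforce split: if_splits)
    show "insert e (covered k I - {f}) \<subseteq> covered k J"
      using i unfolding J covered_def by (fastforce split: if_splits)
  qed
  moreover have "f \<in> covered k I"
    using f i by (auto simp: covered_def)
  ultimately have "card (covered k J) = card (covered k I)"
    using e finite_covered[OF pack] card_Suc_Diff1[of "covered k I" f] by simp
  then show ?thesis
    using I \<open>packing k J\<close> by (simp add: max_packing_def)
qed

lemma reachable_max_packing:
  assumes "max_packing k I" "(exchange k)\<^sup>*\<^sup>* I J"
  shows "max_packing k J"
  using assms(2,1) by induction (auto intro: exchange_max_packing)

section \<open>Elements left over after exchanges\<close>

text \<open>The set called \<open>A\<close> in the outline. The chain of exchanges may be empty, so
  everything that \<open>I\<close> itself leaves uncovered is included.\<close>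

definition loose :: "nat \<Rightarrow> (nat \<Rightarrow> 'e set) \<Rightarrow> 'e set" where
  "loose k I = {e \<in> E. \<exists>J. (exchange k)\<^sup>*\<^sup>* I J \<and> e \<notin> covered k J}"

lemma exchanged_uncovered:
  assumes "packing k I" "i < k" "f \<in> I i" "e \<noteq> f"
  shows "f \<notin> covered k (I(i := insert e (I i - {f})))"
  using assms by (auto simp: covered_def packing_def disjoint_family_on_def split: if_splits)

text \<open>Every element of the fundamental circuit of \<open>e\<close> in \<open>J i\<close> can be exchanged for \<open>e\<close>, so it is
  loose.\<close>

lemma uncovered_in_cl_loose:
  assumes I: "max_packing k I" and IJ: "(exchange k)\<^sup>*\<^sup>* I J" and i: "i < k"
    and e: "e \<in> E - covered k J"
  shows "e \<in> cl (J i \<inter> loose k I)"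
proof -
  have J: "max_packing k J"
    using reachable_max_packing I IJ by blast
  then have pack: "packing k J" and ind: "indep (J i)"
    using i by (auto simp: max_packing_def packing_def)
  have "finite (J i)"
    using ind finite_ground finite_subset by (auto simp: indep_def)
  \<comment> \<open>The fundamental circuit of \<open>e\<close>, without \<open>e\<close>, is
    obtained as an inclusion-minimal subset of \<open>J i\<close> whose closure contains
    \<open>e\<close>.\<close>
  then have "finite {X. X \<subseteq> J i \<and> e \<in> cl X}" (is "finite ?S")
    by simp
  moreover have "?S \<noteq> {}"
    using uncovered_in_cl[OF J i e] by blast
  ultimately obtain X where "X \<in> ?S" and minimal: "\<forall>Y\<in>?S. Y \<subseteq> X \<longrightarrow> X = Y"
    using finite_has_minimal[of ?S] by blast
  then have X: "X \<subseteq> J i" "e \<in> cl X"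
    by simp_all
  have "g \<in> loose k I" if "g \<in> X" for g
  proof -
    have g: "g \<in> J i" "g \<in> E" "e \<noteq> g"
      using that X(1) e ind i by (auto simp: indep_def covered_def)
    have "e \<notin> cl (X - {g})"
      using minimal X(1) that by blast
    then have "g \<in> cl (insert e (X - {g}))"
      using cl_exchange[OF g(2), of e "X - {g}"] X(2) that by (simp add: insert_absorb)
    \<comment> \<open>Were \<open>e\<close> in \<open>cl (J i - {g})\<close>, then \<open>g\<close>
      would be there too, against the independence of \<open>J i\<close>.\<close>
    moreover have "insert e (X - {g}) \<subseteq> cl (J i - {g})" if "e \<in> cl (J i - {g})"
      using that X(1) cl_extensive[of "J i - {g}"] ind by (auto simp: indep_def)
    ultimately have "e \<notin> cl (J i - {g})"
      using cl_least ind g(1) unfolding indep_def by blast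
    then have "exchange k J (J(i := insert e (J i - {g})))"
      using e g(1) i unfolding exchange_def by blast
    then have "(exchange k)\<^sup>*\<^sup>* I (J(i := insert e (J i - {g})))"
      using IJ by simp
    then show ?thesis
      using exchanged_uncovered[OF pack i g(1) g(3)] g(2) unfolding loose_def by blast
  qed
  then have "X \<subseteq> J i \<inter> loose k I"
    using X(1) by blast
  then show ?thesis
    using cl_mono X(2) by blast
qed

text \<open>Both exchanged elements are loose, one being missed by \<open>J\<close> and the other by
  \<open>K\<close>, and swapping them preserves the span of the loose part. This span is thus an
  invariant of exchange chains from \<open>I\<close>.\<close>

lemma exchange_cl_loose:
  assumes I: "max_packing k I" and IJ: "(exchange k)\<^sup>*\<^sup>* I J" and JK: "exchange k J K"
    and j: "j < k"
  shows "cl (K j \<inter> loose k I) = cl (J j \<inter> loose k I)"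
proof -
  obtain i e f where i: "i < k" and e: "e \<in> E" "e \<notin> covered k J" and f: "f \<in> J i"
    and ef: "e \<notin> cl (J i - {f})" and K: "K = J(i := insert e (J i - {f}))"
    using JK by (auto simp: exchange_def)
  have pack: "packing k J"
    using reachable_max_packing[OF I IJ] by (simp add: max_packing_def)
  have "e \<noteq> f"
    using e f i by (auto simp: covered_def)
  then have "f \<notin> covered k K"
    unfolding K using exchanged_uncovered pack i f by blast
  moreover have "(exchange k)\<^sup>*\<^sup>* I K"
    using IJ JK by simp
  moreover have JE: "J i \<subseteq> E"
    using pack i by (auto simp: packing_def indep_def)
  ultimately have fA: "f \<in> loose k I"
    using f unfolding loose_def by blast
  have eA: "e \<in> loose k I"
    using e IJ unfolding loose_def by blast
  show ?thesis
  proof (cases "j = i")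
    case False
    then show ?thesis by (simp add: K)
  next
    case True
    let ?B = "J i \<inter> loose k I"
    have Kj: "K j \<inter> loose k I = insert e (?B - {f})"
      using True eA unfolding K by auto
    have e_in: "e \<in> cl ?B"
      using uncovered_in_cl_loose[OF I IJ i] e by blast
    \<comment> \<open>As \<open>e\<close> depends on \<open>?B\<close> but not on
      \<open>?B - {f}\<close>, exchange makes \<open>f\<close> depend on the new set; the two sets
      then span each other.\<close>
    have "e \<notin> cl (?B - {f})"
      using ef cl_mono[of "?B - {f}" "J i - {f}"] by blast
    moreover have "insert f (?B - {f}) = ?B"
      using f fA by blast
    ultimately have f_in: "f \<in> cl (insert e (?B - {f}))"
      using cl_exchange[of f e "?B - {f}"] e_in f JE by auto
    have "insert e (?B - {f}) \<subseteq> cl ?B"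
      using e_in cl_extensive[of ?B] JE by blast
    moreover have "?B \<subseteq> cl (insert e (?B - {f}))"
      using f_in cl_extensive[of "insert e (?B - {f})"] JE e(1) by blast
    ultimately show ?thesis
      using cl_least Kj True by (simp add: subset_antisym)
  qed
qed

text \<open>A loose element is missed by some reachable \<open>J\<close>, hence spanned by the loose
  part of \<open>J j\<close>; invariance of that span carries this back to \<open>I\<close>.\<close>

lemma loose_subset_cl:
  assumes I: "max_packing k I" and j: "j < k"
  shows "loose k I \<subseteq> cl (I j \<inter> loose k I)"
proof
  fix e assume "e \<in> loose k I"
  then obtain J where J: "(exchange k)\<^sup>*\<^sup>* I J" and e: "e \<in> E - covered k J"
    unfolding loose_def by blast
  from J have "cl (J j \<inter> loose k I) = cl (I j \<inter> loose k I)"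
    by induction (use exchange_cl_loose[OF I _ _ j] in auto)
  then show "e \<in> cl (I j \<inter> loose k I)"
    using uncovered_in_cl_loose[OF I J j e] by simp
qed

text \<open>The hard direction of Edmonds' theorem on covering a matroid by \<open>k\<close>
  independent sets: each \<open>I i \<inter> A\<close> is a basis of \<open>A\<close> and
  \<open>e\<close> is one element more, so the size of \<open>A\<close> exceeds \<open>k\<close>
  times its rank.\<close>

theorem packing_tight_set:
  assumes "\<And>I. packing k I \<Longrightarrow> covered k I \<noteq> E"
  obtains I A e where "packing k I" "A \<subseteq> E" "e \<in> A" "e \<notin> covered k I"
    "\<And>i. i < k \<Longrightarrow> A \<subseteq> cl (I i \<inter> A)"
proof -
  obtain I where I: "max_packing k I"
    using max_packing_exists by blast
  then have pack: "packing k I"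
    by (simp add: max_packing_def)
  then obtain e where e: "e \<in> E" "e \<notin> covered k I"
    using assms covered_subset by blast
  then have "e \<in> loose k I"
    unfolding loose_def by blast
  moreover have "loose k I \<subseteq> E"
    by (auto simp: loose_def)
  ultimately show thesis
    using that pack e(2) loose_subset_cl[OF I] by blast
qed

end

section \<open>Reachability along a set of edges\<close>

text \<open>The relation lives on the whole vertex type, so no vertex set has to be fixed. Keeping
  \<open>\<phi>\<close> and \<open>A\<close> apart lets the edge set vary.\<close>

definition linked :: "('e \<Rightarrow> 'v set) \<Rightarrow> 'e set \<Rightarrow> ('v \<times> 'v) set" where
  "linked \<phi> A = {(u, v). \<exists>e\<in>A. \<phi> e = {u, v}}\<^sup>*"

lemma linked_refl: "(u, u) \<in> linked \<phi> A"
  by (simp add: linked_def)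

lemma linked_edge: "\<lbrakk>e \<in> A; \<phi> e = {u, v}\<rbrakk> \<Longrightarrow> (u, v) \<in> linked \<phi> A"
  unfolding linked_def by blast

lemma linked_trans: "\<lbrakk>(u, v) \<in> linked \<phi> A; (v, w) \<in> linked \<phi> A\<rbrakk> \<Longrightarrow> (u, w) \<in> linked \<phi> A"
  unfolding linked_def by (rule rtrancl_trans)

lemma linked_sym: "(u, v) \<in> linked \<phi> A \<Longrightarrow> (v, u) \<in> linked \<phi> A"
proof -
  have "sym {(u, v). \<exists>e\<in>A. \<phi> e = {u, v}}"
    by (auto simp: sym_def insert_commute)
  then show "(u, v) \<in> linked \<phi> A \<Longrightarrow> (v, u) \<in> linked \<phi> A"
    unfolding linked_def by (meson sym_rtrancl symD)
qed

lemma linked_least: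
  assumes "\<And>e u v. \<lbrakk>e \<in> A; \<phi> e = {u, v}\<rbrakk> \<Longrightarrow> (u, v) \<in> linked \<phi> B"
  shows "linked \<phi> A \<subseteq> linked \<phi> B"
  using assms unfolding linked_def by (intro rtrancl_subset_rtrancl) auto

lemma linked_mono: "A \<subseteq> B \<Longrightarrow> linked \<phi> A \<subseteq> linked \<phi> B"
  by (rule linked_least) (auto intro: linked_edge)

text \<open>A connection needs the new edge at most once, in one of its two directions.\<close>

lemma linked_insert:
  assumes "\<phi> e = {a, b}"
  shows "(x, y) \<in> linked \<phi> (insert e A) \<longleftrightarrow>
    (x, y) \<in> linked \<phi> A \<or> (x, a) \<in> linked \<phi> A \<and> (b, y) \<in> linked \<phi> A \<or>
    (x, b) \<in> linked \<phi> A \<and> (a, y) \<in> linked \<phi> A"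
    (is "?L \<longleftrightarrow> ?R y")
proof
  assume ?L
  then show "?R y"
    unfolding linked_def[of _ "insert e A"]
  proof (induction rule: rtrancl_induct)
    case base
    show ?case by (simp add: linked_refl)
  next
    case (step y z)
    then obtain f where f: "f \<in> insert e A" "\<phi> f = {y, z}" by blast
    show ?case
    proof (cases "f = e")
      case True
      then have "y = a \<and> z = b \<or> y = b \<and> z = a"
        using f(2) assms by (auto simp: doubleton_eq_iff)
      then show ?thesis
        using step.IH linked_refl linked_sym linked_trans by metis
    next
      case False
      then have "(y, z) \<in> linked \<phi> A"
        using f by (auto intro: linked_edge)
      then show ?thesis
        using step.IH linked_trans by metis
    qed
  qed
next
  assume R: "?R y"
  have "(a, b) \<in> linked \<phi> (insert e A)"
    using assms by (auto intro: linked_edge)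
  moreover have "linked \<phi> A \<subseteq> linked \<phi> (insert e A)"
    by (rule linked_mono) blast
  ultimately show ?L
    using R linked_sym linked_trans by (metis subset_iff)
qed

lemma linked_subset_verts:
  assumes "(u, v) \<in> linked \<phi> A" "u \<in> V" "\<And>e. e \<in> A \<Longrightarrow> \<phi> e \<subseteq> V"
  shows "v \<in> V"
  using assms(1) unfolding linked_def
  by (induction rule: rtrancl_induct) (use assms(2,3) in auto)

text \<open>Every vertex on a path from \<open>a\<close> belongs to \<open>U\<close>, so no edge of
  the path leaves \<open>U\<close>.\<close>

lemma linked_component:
  assumes "(a, x) \<in> linked \<phi> A" and U: "U = linked \<phi> A `` {a}"
  shows "(a, x) \<in> linked \<phi> {e \<in> A. \<phi> e \<subseteq> U}"
  using assms(1) unfolding linked_def[of _ A]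
proof (induction rule: rtrancl_induct)
  case base
  show ?case by (rule linked_refl)
next
  case (step y z)
  then obtain e where e: "e \<in> A" "\<phi> e = {y, z}" by blast
  have y: "(a, y) \<in> linked \<phi> A"
    using step.hyps(1) by (simp only: linked_def)
  then have z: "(a, z) \<in> linked \<phi> A"
    by (rule linked_trans) (rule linked_edge[of e A \<phi> y z, OF e])
  have "\<phi> e \<subseteq> U"
    unfolding e(2) U using y z by blast
  then have "(y, z) \<in> linked \<phi> {e \<in> A. \<phi> e \<subseteq> U}"
    using linked_edge[of e "{e \<in> A. \<phi> e \<subseteq> U}" \<phi> y z] e by simp
  with step.IH show ?case
    by (rule linked_trans)
qed

section \<open>Forests\<close>

text \<open>Acyclicity in the form of matroid independence: deleting an edge separates its ends.
  Cycles as lists enter only in \<open>forest_no_cycle\<close>.\<close>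

definition forest :: "('e \<Rightarrow> 'v set) \<Rightarrow> 'e set \<Rightarrow> bool" where
  "forest \<phi> I \<longleftrightarrow> (\<forall>e\<in>I. \<forall>u v. \<phi> e = {u, v} \<longrightarrow> (u, v) \<notin> linked \<phi> (I - {e}))"

lemma forest_subset: "\<lbrakk>forest \<phi> I; J \<subseteq> I\<rbrakk> \<Longrightarrow> forest \<phi> J"
  unfolding forest_def using linked_mono[of "J - {e}" "I - {e}" \<phi> for e] by blast

section \<open>Counting components\<close>

definition components :: "('e \<Rightarrow> 'v set) \<Rightarrow> 'e set \<Rightarrow> 'v set \<Rightarrow> 'v set set" where
  "components \<phi> A V = (\<lambda>x. linked \<phi> A `` {x}) ` V"

lemma linked_class_eq:
  "linked \<phi> A `` {x} = linked \<phi> A `` {y} \<longleftrightarrow> (x, y) \<in> linked \<phi> A"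
  using linked_refl[of y \<phi> A] linked_sym[of _ _ \<phi> A] linked_trans[of _ _ \<phi> A] by blast

text \<open>The distinct classes of \<open>a\<close> and \<open>b\<close> merge; all other classes
  stay as they are.\<close>

lemma card_components_insert:
  assumes "finite V" "\<phi> e = {a, b}" "a \<in> V" "b \<in> V" "(a, b) \<notin> linked \<phi> A"
  shows "Suc (card (components \<phi> (insert e A) V)) = card (components \<phi> A V)"
proof -
  let ?C = "\<lambda>x. linked \<phi> A `` {x}" and ?D = "\<lambda>x. linked \<phi> (insert e A) `` {x}"
  have D_in: "?D x = ?C a \<union> ?C b" if "(x, a) \<in> linked \<phi> A \<or> (x, b) \<in> linked \<phi> A" for x
    using that linked_insert[of \<phi> e a b x _ A, OF assms(2)] linked_sym[of _ _ \<phi> A]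
      linked_trans[of _ _ \<phi> A] linked_refl[of _ \<phi> A] by blast
  have D_out: "?D x = ?C x" if "(x, a) \<notin> linked \<phi> A" "(x, b) \<notin> linked \<phi> A" for x
    using that linked_insert[of \<phi> e a b x _ A, OF assms(2)] by blast
  \<comment> \<open>The vertices outside both merging classes; their classes are common to the old
    and the new partition.\<close>
  let ?W = "{x \<in> V. (x, a) \<notin> linked \<phi> A \<and> (x, b) \<notin> linked \<phi> A}"
  have "?D ` V = insert (?C a \<union> ?C b) (?C ` ?W)"
  proof (intro equalityI subsetI)
    fix X assume "X \<in> ?D ` V"
    then obtain x where "x \<in> V" "X = ?D x" by blast
    then show "X \<in> insert (?C a \<union> ?C b) (?C ` ?W)"
      using D_in[of x] D_out[of x] by blast
  next
    fix X assume "X \<in> insert (?C a \<union> ?C b) (?C ` ?W)"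
    then consider "X = ?C a \<union> ?C b" | x where "x \<in> ?W" "X = ?C x" by blast
    then show "X \<in> ?D ` V"
    proof cases
      case 1
      then show ?thesis using D_in[of a] linked_refl[of a \<phi> A] assms(3) by blast
    next
      case 2
      then show ?thesis using D_out[of x] by blast
    qed
  qed
  moreover have "?C a \<union> ?C b \<notin> ?C ` ?W"
  proof
    assume "?C a \<union> ?C b \<in> ?C ` ?W"
    then obtain x where "x \<in> ?W" "?C x = ?C a \<union> ?C b" by blast
    then show False using linked_refl[of a \<phi> A] by blast
  qed
  ultimately have 1: "card (?D ` V) = Suc (card (?C ` ?W))"
    using assms(1) by simp
  have "?C ` V = insert (?C a) (insert (?C b) (?C ` ?W))"
  proof (intro equalityI subsetI)
    fix X assume "X \<in> ?C ` V"
    then obtain x where "x \<in> V" "X = ?C x" by blast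
    then show "X \<in> insert (?C a) (insert (?C b) (?C ` ?W))"
      using linked_class_eq[of \<phi> A x a] linked_class_eq[of \<phi> A x b] by blast
  qed (use assms(3,4) in auto)
  moreover have "?C a \<noteq> ?C b"
    using assms(5) linked_class_eq by metis
  moreover have "?C a \<notin> ?C ` ?W" "?C b \<notin> ?C ` ?W"
    using linked_class_eq[of \<phi> A _ a] linked_class_eq[of \<phi> A _ b] by auto
  ultimately have "card (?C ` V) = Suc (Suc (card (?C ` ?W)))"
    using assms(1) by simp
  then show ?thesis
    using 1 by (simp add: components_def)
qed

text \<open>Starting from \<open>card V\<close> singletons, each forest edge lowers the number of
  components by one.\<close>

lemma card_forest:
  assumes "finite I" "finite V" "forest \<phi> I" "\<And>e. e \<in> I \<Longrightarrow> card (\<phi> e) = 2 \<and> \<phi> e \<subseteq> V"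
  shows "card I + card (components \<phi> I V) = card V"
  using assms(1,3,4)
proof (induction I rule: finite_induct)
  case empty
  have "components \<phi> {} V = (\<lambda>x. {x}) ` V"
    by (auto simp: components_def linked_def)
  then show ?case by (simp add: card_image)
next
  case (insert e I)
  obtain a b where ab: "\<phi> e = {a, b}"
    using insert.prems(2)[of e] by (auto simp: card_2_iff)
  then have "(a, b) \<notin> linked \<phi> I"
    using insert.prems(1) insert.hyps(2) unfolding forest_def by auto
  moreover have "a \<in> V" "b \<in> V"
    using insert.prems(2)[of e] ab by auto
  ultimately have "Suc (card (components \<phi> (insert e I) V)) = card (components \<phi> I V)"
    using card_components_insert assms(2) ab by metis
  moreover have "card I + card (components \<phi> I V) = card V"
    using insert.IH insert.prems forest_subset[of \<phi> "insert e I" I] by blast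
  ultimately show ?case
    using insert.hyps by simp
qed

lemma card_forest_less:
  assumes "finite I" "finite V" "V \<noteq> {}" "forest \<phi> I"
    "\<And>e. e \<in> I \<Longrightarrow> card (\<phi> e) = 2 \<and> \<phi> e \<subseteq> V"
  shows "card I < card V"
proof -
  have "card (components \<phi> I V) > 0"
    using assms(2,3) by (simp add: components_def card_gt_0_iff)
  then show ?thesis
    using card_forest[OF assms(1,2,4,5)] by simp
qed

text \<open>Exactly one component remains in the general count.\<close>

lemma card_spanning_forest:
  assumes "finite I" "finite V" "a \<in> V" "forest \<phi> I"
    "\<And>e. e \<in> I \<Longrightarrow> card (\<phi> e) = 2 \<and> \<phi> e \<subseteq> V"
    and "\<And>x. x \<in> V \<Longrightarrow> (a, x) \<in> linked \<phi> I"
  shows "Suc (card I) = card V"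
proof -
  have "components \<phi> I V = {linked \<phi> I `` {a}}"
    using assms(3,6) linked_class_eq[of \<phi> I a] unfolding components_def by auto
  then show ?thesis
    using card_forest[OF assms(1,2,4,5)] by simp
qed

section \<open>Cycles and walks\<close>

lemma linked_list:
  assumes "\<And>i. i < n \<Longrightarrow> es i \<in> A \<and> \<phi> (es i) = {vs i, vs (Suc i)}"
  shows "(vs 0, vs n) \<in> linked \<phi> A"
  using assms
proof (induction n)
  case 0
  show ?case by (rule linked_refl)
next
  case (Suc n)
  then have "(vs 0, vs n) \<in> linked \<phi> A" "(vs n, vs (Suc n)) \<in> linked \<phi> A"
    by (auto intro: linked_edge)
  then show ?case by (rule linked_trans)
qed

text \<open>The rest of a cycle links the ends of its first edge without using that edge.\<close>

lemma forest_no_cycle: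
  assumes "forest (ends G) (edges G)"
  shows "\<not> is_cycle G vs es"
proof
  assume c: "is_cycle G vs es"
  let ?n = "length es" and ?w = "\<lambda>i. vs ! (i mod length es)" and ?R = "edges G - {es ! 0}"
  have len: "length vs = ?n" "2 \<le> ?n" and dist: "distinct es"
    using c by (auto simp: is_cycle_def)
  have es: "es ! i \<in> edges G" "ends G (es ! i) = {?w i, ?w (Suc i)}" if "i < ?n" for i
    using c that by (auto simp: is_cycle_def)
  have "(?w (Suc 0), ?w (Suc (?n - 1))) \<in> linked (ends G) ?R"
  \<comment> \<open>Shifted by one, the path uses the edges \<open>1\<close> to
    \<open>?n - 1\<close> and ends at index \<open>?n\<close>, which \<open>?w\<close> reduces to
    \<open>0\<close>.\<close>
  proof (rule linked_list[of "?n - 1" "\<lambda>i. es ! Suc i" ?R "ends G" "\<lambda>i. ?w (Suc i)"])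
    fix i assume "i < ?n - 1"
    then have i: "Suc i < ?n" "0 < ?n" by auto
    then have "es ! Suc i \<noteq> es ! 0"
      using nth_eq_iff_index_eq[OF dist i] by simp
    then show "es ! Suc i \<in> ?R \<and> ends G (es ! Suc i) = {?w (Suc i), ?w (Suc (Suc i))}"
      using es[OF i(1)] by blast
  qed
  moreover have "Suc (?n - 1) = ?n"
    using len(2) by linarith
  ultimately have "(?w 0, ?w (Suc 0)) \<in> linked (ends G) ?R"
    using linked_sym[of "?w (Suc 0)" "?w 0" "ends G" ?R] by simp
  moreover have "0 < ?n"
    using len(2) by linarith
  ultimately show False
    using assms es[of 0] unfolding forest_def by blast
qed

text \<open>Walks grow at the front, hence the converse induction; the empty walk requires
  \<open>v\<close> to be a vertex.\<close>

lemma linked_walk: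
  assumes "(u, v) \<in> linked (ends G) (edges G)" "v \<in> verts G"
  shows "\<exists>es. walk G u es v"
  using assms(1) unfolding linked_def
proof (induction rule: converse_rtrancl_induct)
  case base
  have "walk G v [] v" using assms(2) by simp
  then show ?case by blast
next
  case (step y z)
  then obtain e es where "e \<in> edges G" "ends G e = {y, z}" "walk G z es v" by blast
  then have "walk G y (e # es) v" by auto
  then show ?case by blast
qed

section \<open>Graphs\<close>

context fin_multigraph
begin

section \<open>The graphic matroid of a multigraph\<close>

lemma ends_card_subset: "e \<in> edges G \<Longrightarrow> card (ends G e) = 2 \<and> ends G e \<subseteq> verts G"
  using card_ends ends_subset by blast

lemma ends_pair: "e \<in> edges G \<Longrightarrow> \<exists>u v. ends G e = {u, v}"
  using card_ends unfolding card_2_iff by blast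

text \<open>The closure operator of the graphic matroid, whose independent sets are the
  forests.\<close>

definition span_edges :: "'e set \<Rightarrow> 'e set" where
  "span_edges A = {e \<in> edges G. \<exists>u v. ends G e = {u, v} \<and> (u, v) \<in> linked (ends G) A}"

lemma span_edges_iff:
  assumes "ends G e = {u, v}"
  shows "e \<in> span_edges A \<longleftrightarrow> e \<in> edges G \<and> (u, v) \<in> linked (ends G) A"
  using assms linked_sym[of _ _ "ends G" A] unfolding span_edges_def
  by (auto simp: doubleton_eq_iff)

lemma linked_span_edges:
  assumes "A \<subseteq> span_edges B"
  shows "linked (ends G) A \<subseteq> linked (ends G) B"
  using assms span_edges_iff by (intro linked_least) blast

lemma pregeometry_span_edges: "pregeometry (edges G) span_edges"
proof
  show "finite (edges G)"
    by (rule finite_edges)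
  show "span_edges A \<subseteq> edges G" for A
    by (auto simp: span_edges_def)
  show "A \<subseteq> span_edges A" if "A \<subseteq> edges G" for A
  proof
    fix e assume "e \<in> A"
    with that obtain u v where "ends G e = {u, v}"
      using ends_pair by blast
    then show "e \<in> span_edges A"
      using span_edges_iff \<open>e \<in> A\<close> that by (auto intro: linked_edge)
  qed
  show "span_edges A \<subseteq> span_edges B" if "A \<subseteq> B" for A B
    using linked_mono[OF that, of "ends G"] unfolding span_edges_def by blast
  show "span_edges (span_edges A) \<subseteq> span_edges A" for A
    using linked_span_edges[of "span_edges A" A] unfolding span_edges_def by blast
  show "y \<in> span_edges (insert x A)"
    if y: "y \<in> edges G" and x: "x \<in> span_edges (insert y A)" "x \<notin> span_edges A" for x y A
  proof -
    obtain a b where ab: "ends G y = {a, b}"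
      using ends_pair y by blast
    obtain c d where cd: "ends G x = {c, d}"
      using x(1) by (auto simp: span_edges_def)
    show ?thesis
      \<comment> \<open>As \<open>A\<close> alone does not link \<open>c\<close> to
        \<open>d\<close>, the connection passes through \<open>y\<close>: up to order,
        \<open>A\<close> links \<open>c\<close> to \<open>a\<close> and \<open>b\<close> to
        \<open>d\<close>. Adding \<open>x\<close> then links \<open>a\<close> to
        \<open>b\<close>.\<close>
      using x y span_edges_iff[OF ab] span_edges_iff[OF cd]
        linked_insert[of "ends G" y a b, OF ab] linked_insert[of "ends G" x c d, OF cd]
        linked_sym[of _ _ "ends G" A] by metis
  qed
qed

sublocale pregeometry "edges G" span_edges
  by (rule pregeometry_span_edges)

lemma indep_forest: "indep I \<Longrightarrow> forest (ends G) I"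
  unfolding indep_def forest_def using span_edges_iff by blast

section \<open>Dense graphs that are sparse on every proper vertex subset\<close>

lemma subgraph_restrict:
  assumes "U \<subseteq> verts G" "U \<noteq> {}" "F \<subseteq> {e \<in> edges G. ends G e \<subseteq> U}"
  shows "subgraph \<lparr>verts = U, edges = F, ends = ends G\<rparr> G"
proof -
  have "finite U" "finite F"
    using assms finite_subset[OF _ finite_verts] finite_subset[OF _ finite_edges] by blast+
  then show ?thesis
    using assms card_ends by (auto simp: subgraph_def fin_multigraph_def)
qed

text \<open>The hypothesis \<open>sparse\<close> is what vertex-minimality of the dense subgraph provides.\<close>

lemma edge_disjoint_spanning_trees:
  assumes dense: "card (edges G) > k * (card (verts G) - 1)"
    and sparse: "\<And>U. \<lbrakk>U \<noteq> {}; U \<subset> verts G\<rbrakk> \<Longrightarrow>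
      card {e \<in> edges G. ends G e \<subseteq> U} \<le> k * (card U - 1)"
  shows "has_edge_disjoint_spanning_trees k G"
proof -
  have small: "card (I i) \<le> card (verts G) - 1" if "packing k I" "i < k" for I i
  proof -
    have "indep (I i)"
      using that by (simp add: packing_def)
    moreover have "I i \<subseteq> edges G"
      using \<open>indep (I i)\<close> by (simp add: indep_def)
    ultimately show ?thesis
      using card_forest_less[of "I i" "verts G" "ends G"] indep_forest ends_card_subset
        finite_subset[OF _ finite_edges] finite_verts verts_nonempty by fastforce
  qed
  \<comment> \<open>Together \<open>k\<close> forests have at most
    \<open>k * (card (verts G) - 1)\<close> edges, fewer than \<open>dense\<close> provides.\<close>
  have not_cover: "covered k I \<noteq> edges G" if "packing k I" for I
  proof -
    have "card (covered k I) \<le> (\<Sum>i<k. card (I i))"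
      unfolding covered_def by (rule card_UN_le) simp
    also have "\<dots> \<le> (\<Sum>i<k. card (verts G) - 1)"
      using small[OF that] by (intro sum_mono) simp
    also have "\<dots> < card (edges G)"
      using dense by simp
    finally show ?thesis by auto
  qed
  obtain I A e where I: "packing k I" and A: "A \<subseteq> edges G" and e: "e \<in> A" "e \<notin> covered k I"
    and span: "\<And>i. i < k \<Longrightarrow> A \<subseteq> span_edges (I i \<inter> A)"
    using packing_tight_set[of k] not_cover by metis
  obtain a b where ab: "ends G e = {a, b}"
    using ends_pair e(1) A by blast
  define U where "U = linked (ends G) A `` {a}"
  have aV: "a \<in> verts G"
    using ends_subset[of e] ab e(1) A by auto
  have "U \<subseteq> verts G"
    using linked_subset_verts[of a _ "ends G" A "verts G"] aV A ends_subset
    unfolding U_def by blast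
  have "a \<in> U"
    by (simp add: U_def linked_refl)
  have "b \<in> U"
    using linked_edge[of e A "ends G"] e(1) ab by (simp add: U_def)
  \<comment> \<open>The part of \<open>I i \<inter> A\<close> inside the component \<open>U\<close>;
    it turns out to be a spanning tree of \<open>U\<close>.\<close>
  define F where "F i = {f \<in> I i \<inter> A. ends G f \<subseteq> U}" for i
  have ind: "indep (I i)" if "i < k" for i
    using I that by (simp add: packing_def)
  have F_linked: "(a, x) \<in> linked (ends G) (F i)" if "i < k" "x \<in> U" for i x
  proof -
    \<comment> \<open>Since \<open>I i \<inter> A\<close> spans \<open>A\<close>, it has the same
      components as \<open>A\<close>.\<close>
    have "linked (ends G) (I i \<inter> A) = linked (ends G) A"
      using linked_span_edges[OF span[OF that(1)]] linked_mono[of "I i \<inter> A" A "ends G"] by blast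
    then show ?thesis
      using linked_component[of a x "ends G" "I i \<inter> A" U] that(2) by (simp add: U_def F_def)
  qed
  have F_sub: "F i \<subseteq> edges G" for i
    using A by (auto simp: F_def)
  have F_card: "card (F i) = card U - 1" if "i < k" for i
  proof -
    have "forest (ends G) (F i)"
      using indep_forest[OF ind[OF that]] by (rule forest_subset) (auto simp: F_def)
    moreover have "card (ends G f) = 2 \<and> ends G f \<subseteq> U" if "f \<in> F i" for f
      using that F_sub card_ends by (auto simp: F_def)
    moreover have "finite (F i)" "finite U"
      using F_sub finite_edges \<open>U \<subseteq> verts G\<close> finite_verts finite_subset by blast+
    ultimately have "Suc (card (F i)) = card U"
      using F_linked[OF that] \<open>a \<in> U\<close> card_spanning_forest by metis
    then show ?thesis by simp
  qed
  have "k * (card U - 1) = (\<Sum>i<k. card (F i))"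
    using F_card by simp
  also have "\<dots> = card (\<Union>i<k. F i)"
  proof (rule card_UN_disjoint[symmetric])
    show "\<forall>i\<in>{..<k}. finite (F i)"
      using F_sub finite_edges finite_subset by blast
    show "\<forall>i\<in>{..<k}. \<forall>j\<in>{..<k}. i \<noteq> j \<longrightarrow> F i \<inter> F j = {}"
      using I unfolding F_def packing_def disjoint_family_on_def by blast
  qed simp
  \<comment> \<open>The inclusion is strict because the uncovered edge \<open>e\<close> lies inside
    \<open>U\<close> but in no \<open>F i\<close>.\<close>
  also have "\<dots> < card {f \<in> edges G. ends G f \<subseteq> U}"
  proof (rule psubset_card_mono)
    show "finite {f \<in> edges G. ends G f \<subseteq> U}"
      using finite_edges by simp
    have "(\<Union>i<k. F i) \<subseteq> {f \<in> edges G. ends G f \<subseteq> U}"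
      using F_sub by (auto simp: F_def)
    moreover have "e \<notin> (\<Union>i<k. F i)"
      using e(2) by (auto simp: F_def covered_def)
    moreover have "e \<in> {f \<in> edges G. ends G f \<subseteq> U}"
      using e(1) A ab \<open>a \<in> U\<close> \<open>b \<in> U\<close> by auto
    ultimately show "(\<Union>i<k. F i) \<subset> {f \<in> edges G. ends G f \<subseteq> U}"
      by blast
  qed
  \<comment> \<open>A proper subset with this many edges inside would contradict
    \<open>sparse\<close>.\<close>
  finally have "U = verts G"
    using sparse[of U] \<open>U \<subseteq> verts G\<close> \<open>a \<in> U\<close> by force
  define T where "T i = \<lparr>verts = verts G, edges = I i, ends = ends G\<rparr>" for i
  have "spanning_tree (T i) G" if i: "i < k" for i
  proof -
    have "I i \<subseteq> {e \<in> edges G. ends G e \<subseteq> verts G}"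
      using ind[OF i] ends_subset by (auto simp: indep_def)
    then have sub: "subgraph (T i) G"
      unfolding T_def using verts_nonempty by (intro subgraph_restrict) auto
    have "(a, x) \<in> linked (ends G) (I i)" if "x \<in> verts G" for x
      using F_linked[OF i] that linked_mono[of "F i" "I i" "ends G"] \<open>U = verts G\<close>
      by (auto simp: F_def)
    then have "(x, y) \<in> linked (ends G) (I i)" if "x \<in> verts G" "y \<in> verts G" for x y
      using that linked_sym linked_trans by metis
    then have "connected_graph (T i)"
      using linked_walk[of _ _ "T i"] by (simp add: connected_graph_def T_def)
    moreover have "\<not> is_cycle (T i) vs es" for vs es
      using forest_no_cycle[of "T i"] indep_forest[OF ind[OF i]] by (simp add: T_def)
    ultimately show ?thesis
      using sub by (simp add: spanning_tree_def tree_def subgraph_def T_def)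
  qed
  moreover have "disjoint_family_on (\<lambda>i. edges (T i)) {..<k}"
    using I by (simp add: T_def packing_def)
  ultimately show ?thesis
    unfolding has_edge_disjoint_spanning_trees_def by blast
qed

text \<open>Sparsity allows at most \<open>k * (card (verts G) - 2)\<close> edges within the two
  sides together, so by density more than \<open>k\<close> edges cross.\<close>

lemma edge_connected_if_minimal_dense:
  assumes dense: "card (edges G) > k * (card (verts G) - 1)"
    and sparse: "\<And>U. \<lbrakk>U \<noteq> {}; U \<subset> verts G\<rbrakk> \<Longrightarrow>
      card {e \<in> edges G. ends G e \<subseteq> U} \<le> k * (card U - 1)"
  shows "edge_connected (k + 1) G"
  unfolding edge_connected_def
proof (intro allI impI, elim conjE)
  fix A B assume A: "A \<noteq> {}" and B: "B \<noteq> {}" and disj: "A \<inter> B = {}" and V: "A \<union> B = verts G"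
  let ?EA = "{e \<in> edges G. ends G e \<subseteq> A}" and ?EB = "{e \<in> edges G. ends G e \<subseteq> B}"
  have fin: "finite A" "finite B"
    using V finite_verts by (metis finite_Un)+
  have "edges G \<subseteq> ?EA \<union> ?EB \<union> edges_between G A B"
  proof
    fix e assume e: "e \<in> edges G"
    then obtain u v where uv: "ends G e = {u, v}"
      using ends_pair by blast
    then have "u \<in> A \<union> B" "v \<in> A \<union> B"
      using ends_subset[OF e] V by auto
    then show "e \<in> ?EA \<union> ?EB \<union> edges_between G A B"
      using e uv by (auto simp: edges_between_def insert_commute)
  qed
  then have "card (edges G) \<le> card (?EA \<union> ?EB \<union> edges_between G A B)"
    using finite_edges by (intro card_mono) (auto simp: edges_between_def)
  also have "\<dots> \<le> card ?EA + card ?EB + card (edges_between G A B)"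
    by (meson add_le_mono1 card_Un_le le_trans)
  also have "\<dots> \<le> k * (card A - 1) + k * (card B - 1) + card (edges_between G A B)"
    using sparse[of A] sparse[of B] A B disj V by (intro add_mono) auto
  finally have "k * (card (verts G) - 1) <
      k * (card A - 1) + k * (card B - 1) + card (edges_between G A B)"
    using dense by simp
  \<comment> \<open>Both sides are nonempty, so the truncated subtractions are exact.\<close>
  moreover have "card (verts G) - 1 = (card A - 1) + (card B - 1) + 1"
  proof -
    have "card A > 0" "card B > 0"
      using A B fin by (simp_all add: card_gt_0_iff)
    then show ?thesis
      using card_Un_disjoint[OF fin disj] unfolding V by linarith
  qed
  ultimately show "k + 1 \<le> card (edges_between G A B)"
    by (simp add: add_mult_distrib2)
qed

text \<open>A simple graph has at most one edge per pair of vertices; comparing this bound with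
  density leaves \<open>2 * k < ?n\<close>.\<close>

lemma dense_simple_order:
  assumes dense: "card (edges G) > k * (card (verts G) - 1)" and inj: "inj_on (ends G) (edges G)"
  shows "card (verts G) > 2 * k"
proof -
  let ?n = "card (verts G)"
  have "card (edges G) \<le> card {X. X \<subseteq> verts G \<and> card X = 2}"
    using inj ends_card_subset finite_verts by (intro card_inj_on_le[of "ends G"]) auto
  also have "\<dots> = ?n * (?n - 1) div 2"
    using n_subsets[OF finite_verts] choose_two by simp
  finally have "k * (?n - 1) < ?n * (?n - 1) div 2"
    using dense by simp
  then have "2 * k * (?n - 1) < ?n * (?n - 1)"
    by linarith
  \<comment> \<open>The strict inequality forces \<open>?n - 1\<close> to be positive, so this
    factor cancels.\<close>
  then show ?thesis
    by simp
qed

end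

section \<open>The dense subgraph with fewest vertices\<close>

text \<open>Graphs have at least one vertex, so integer and truncated subtraction of 1
  agree.\<close>

lemma dense_int_iff:
  assumes "fin_multigraph H"
  shows "int (num_edges H) > int k * (int (num_verts H) - 1) \<longleftrightarrow>
    card (edges H) > k * (card (verts H) - 1)"
proof -
  have "card (verts H) \<ge> 1"
    using assms by (simp add: fin_multigraph_def Suc_leI card_gt_0_iff)
  then have "int k * (int (num_verts H) - 1) = int (k * (card (verts H) - 1))"
    by (simp add: num_verts_def of_nat_diff)
  then show ?thesis
    by (simp only: num_edges_def of_nat_less_iff)
qed

lemma subgraph_trans: "\<lbrakk>subgraph H G; subgraph K H\<rbrakk> \<Longrightarrow> subgraph K G"
  by (auto simp: subgraph_def subset_iff)

theorem theorem4:
  fixes G :: "('v, 'e) multigraph" and k :: nat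
  assumes "k \<ge> 1"
    and "fin_multigraph G"
    and "int (num_edges G) > int k * (int (num_verts G) - 1)"
  shows "\<exists>G'. subgraph G' G \<and>
           int (num_edges G') > int k * (int (num_verts G') - 1) \<and>
           edge_connected (k + 1) G' \<and>
           has_edge_disjoint_spanning_trees k G' \<and>
           (simple_graph G \<longrightarrow> num_verts G' > 2 * k)"
proof -
  let ?P = "\<lambda>H. subgraph H G \<and> card (edges H) > k * (card (verts H) - 1)"
  have "?P G"
    using assms dense_int_iff by (auto simp: subgraph_def)
  \<comment> \<open>Only the number of vertices is minimised; this is what bounds the edges inside
    every proper vertex subset.\<close>
  then obtain H where H: "subgraph H G" and dense: "card (edges H) > k * (card (verts H) - 1)"
    and min: "\<And>K. ?P K \<Longrightarrow> card (verts H) \<le> card (verts K)"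
    using ex_has_least_nat[of ?P G "\<lambda>H. card (verts H)"] by blast
  then interpret H: fin_multigraph H
    by (simp add: subgraph_def)
  have sparse: "card {e \<in> edges H. ends H e \<subseteq> U} \<le> k * (card U - 1)"
    if "U \<noteq> {}" "U \<subset> verts H" for U
  proof (rule ccontr)
    \<comment> \<open>The subgraph induced on \<open>U\<close> would be dense with fewer vertices
      than \<open>H\<close>.\<close>
    let ?K = "\<lparr>verts = U, edges = {e \<in> edges H. ends H e \<subseteq> U}, ends = ends H\<rparr>"
    assume "\<not> ?thesis"
    moreover have "subgraph ?K G"
      using H.subgraph_restrict[of U] that subgraph_trans[OF H] by blast
    ultimately have "card (verts H) \<le> card U"
      using min[of ?K] by simp
    then show False
      using psubset_card_mono[OF H.finite_verts that(2)] by simp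
  qed
  have "num_verts H > 2 * k" if "simple_graph G"
  proof -
    have "inj_on (ends H) (edges H)"
      using that H by (auto simp: simple_graph_def subgraph_def inj_on_def subset_iff)
    then show ?thesis
      using H.dense_simple_order dense by (simp add: num_verts_def)
  qed
  then show ?thesis
    using H dense H.edge_connected_if_minimal_dense[OF dense sparse]
      H.edge_disjoint_spanning_trees[OF dense sparse] dense_int_iff[OF H.fin_multigraph_axioms]
    by blast
qed

end
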